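(* (i) For every signature $S$, every $S$-database $D$, every collection $\bar{\mathcal{D}}$ of updates over $D$ and every valid deduction $\phi_0,\ldots,\phi_n$ with support $\{\phi_0,\ldots,\phi_k\}\{\phi_n\}$, if $\phi_0,\ldots,\phi_n$ is over $S$ (all its symbols are in $S$), then $I_{\bar{\mathcal{D}}}((\phi_0\wedge\cdots\wedge\phi_k)\to\phi_n)=0$. (ii) However, it is not necessarily the case that $I_{\bar{\mathcal{D}}}(\{\phi_0,\ldots,\phi_k\}\{\phi_n\})=0$: there exist $S$, an $S$-database $D$, a collection $\bar{\mathcal{D}}$ of updates over $D$ and a valid deduction $\phi_0,\ldots,\phi_n$ over $S$ with support $\{\phi_0,\ldots,\phi_k\}\{\phi_n\}$ such that $I_{\bar{\mathcal{D}}}(\{\phi_0,\ldots,\phi_k\}\{\phi_n\})\neq 0$. (iii) Moreover, for every $S$-database $D$ and every valid deduction $\phi_0,\ldots,\phi_n$ with support $\{\phi_0,\ldots,\phi_k\}\{\phi_n\}$, if $\phi_0,\ldots,\phi_n$ has symbols not in $S$, then there are collections $\bar{\mathcal{D}}$ of updates over $D$ for which $I_{\bar{\mathcal{D}}}((\phi_0\wedge\cdots\wedge\phi_k)\to\phi_n)>0$.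
   Context: **Conventions.** Propositions are classical first-order sentences. Signatures consist of constants (the symbols of arity $0$) and relation/function symbols of arity $>0$. $A(\sigma)$ is the interpretation of the symbol $\sigma$ in the structure $A$. $A(\phi)=1$ means that $\phi$ is true in $A$ (which requires that $A$ interprets all symbols of $\phi$). **Databases.** An $S$-database is a pair $D=(A,T)$ where $A$ is a finite first-order structure over $S$ and $T$ is a finite classical first-order theory over $S$ with $A(\phi)=1$ for all $\phi\in T$. **Insertion.** An insertion of an $n$-ary symbol $\sigma$ into an $S$-database $D=(A,T)$ is a database $D'=(A',T)$, with $A'$ a structure over $S'=S\cup\{\sigma\}$, such that: (1) $A'(\tau)=A(\tau)$ for all $\tau\in S$, $\tau\neq\sigma$; (2) if $n=0$ and $\sigma\in S$, then $dom(A')=dom(A)$ and $A'(\sigma)=A(\sigma)$; if $n=0$ and $\sigma\notin S$, then $dom(A')=dom(A)\cup\{a\}$ and $A'(\sigma)=a$ for some object $a$ (possibly already in $dom(A)$); (3) if $n>0$, then $dom(A')=dom(A)\cup\{a_1,\ldots,a_n\}$ and $A'(\sigma)=A(\sigma)\cup\{(a_1,\ldots,a_n)\}$ for some objects $a_1,\ldots,a_n$ (with $A(\sigma)$ read as empty if $\sigma\notin S$); in all cases provided $A'(\phi)=1$ for all $\phi\in T$. **Deletion.** An element $a\in dom(A)$ is free for $\sigma\in S$ if there is no constant $\tau\in S$, $\tau\ne\sigma$, with $A(\tau)=a$, and no symbol $\delta\neq\sigma$ of arity $m>0$ with a tuple $(b_1,\ldots,b_m)\in A(\delta)$ such that $a=b_i$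 for some $i$. A deletion of an $n$-ary symbol $\sigma$ from $D=(A,T)$ is a database $D'=(A',T)$, with $A'$ a structure over $S'$, where $S'=S$ or $S'=S-\{\sigma\}$, such that: (1) $A'(\tau)=A(\tau)$ for all $\tau\in S-\{\sigma\}$; (2) if $n=0$ and $S'=S$, then $dom(A')=dom(A)$ and $A'(\sigma)=a$ for some $a\in dom(A)$ with $a\neq A(\sigma)$; if $n=0$ and $S'=S-\{\sigma\}$, then $dom(A')=dom(A)-\{A(\sigma)\}$ if $A(\sigma)$ is free for $\sigma$, and $dom(A')=dom(A)$ otherwise; (3) if $n>0$ and $S'=S$, then $dom(A')=dom(A)$ and $A'(\sigma)=A(\sigma)-\{(a_1,\ldots,a_n)\}$ for some tuple; if $n>0$ and $S'=S-\{\sigma\}$, then $dom(A')=dom(A)-\{c_1,\ldots,c_k\}$, where each $c_i$ is an entry of some tuple of $A(\sigma)$ and is free for $\sigma$; in all cases provided $A'(\phi)=1$ for all $\phi\in T$. **Updates.** An update of (or over) $D$ is an at most enumerable sequence $\mathcal{D}=(D_i:i<\alpha)$ with $D_0=D$ and each $D_{i+1}$ an insertion into or a deletion from $D_i$ (of some symbol). Write $D_i=(A_i,T)$. $\mathcal{D}$ is satisfactory for $\phi$, written $\mathcal{D}(\phi)=1$, if $\alpha=n+1$ for some $n\in\mathbb{N}$ and $A_n(\phi)=1$; otherwise it is unsatisfactory for $\phi$, written $\mathcal{D}(\phi)=0$. If $\mathcal{D}=(D_i:i<n)$ is satisfactory for $\phi$, put $\|\mathcal{D}\|=\min\{i<n: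 A_i(\phi)=1\}$ (this depends on $\phi$). **Complexity.** For a collection $\bar{\mathcal{D}}$ of updates over $D$, $C_{\bar{\mathcal{D}}}(\phi)=\min\{\|\mathcal{D}\|:\mathcal{D}\in\bar{\mathcal{D}},\ \mathcal{D}(\phi)=1\}$ if some $\mathcal{D}\in\bar{\mathcal{D}}$ is satisfactory for $\phi$, and $C_{\bar{\mathcal{D}}}(\phi)=0$ otherwise. $C_{\bar{\mathcal{D}}}(\{\phi_0,\ldots,\phi_n\})=\sum_{i=0}^n C_{\bar{\mathcal{D}}}(\phi_i)$, and the complexity $C_{\bar{\mathcal{D}}}(\phi_0,\ldots,\phi_n)$ of a deduction is that of the set $\{\phi_0,\ldots,\phi_n\}$. **Relevancy.** A deduction is a finite sequence of propositions $\phi_0,\ldots,\phi_n$ whose first propositions $\phi_0,\ldots,\phi_k$ ($k\le n$) are its premisses and whose last proposition $\phi_n$ is its conclusion; it is valid if the premisses imply the conclusion. Its support is the set $\{\phi_0,\ldots,\phi_k\}\cup\{\phi_n\}$, written $\{\phi_0,\ldots,\phi_k\}\{\phi_n\}$. For an update $\mathcal{D}$ of $D=(A,T)$ and a finite set $\Gamma$ of formulas, $\mathcal{D}(\Gamma)=\{\phi\in\Gamma:\mathcal{D}(\phi)=1\text{ and }T\nvDash\phi\}$, where $T\nvDash\phi$ means that $\phi$ is not a logical consequence of $T$. If the deduction is valid and some update in $\bar{\mathcal{D}}$ is satisfactory for $\phi_n$, then $$R_{\bar{\mathcal{D}}}(\phi_0,\ldots,\phi_n)=\frac{|\mathcal{D}(\{\phi_0,\ldots,\phi_k\}\{\phi_n\})|}{|\{\phi_0,\ldots,\phi_k\}\{\phi_n\}|},$$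 where $\mathcal{D}$ is the smallest (least length) update in $\bar{\mathcal{D}}$ satisfactory for $\phi_n$; otherwise $R_{\bar{\mathcal{D}}}(\phi_0,\ldots,\phi_n)=0$. **Semantic informativity.** $I_{\bar{\mathcal{D}}}(\phi_0,\ldots,\phi_n)=C_{\bar{\mathcal{D}}}(\phi_0,\ldots,\phi_n)\cdot R_{\bar{\mathcal{D}}}(\phi_0,\ldots,\phi_n)$. For a single proposition $\phi$, $I_{\bar{\mathcal{D}}}(\phi)$ is the informativity of the one-term deduction $\phi$ (with $\phi$ as premiss and conclusion, so its support is $\{\phi\}$). $I_{\bar{\mathcal{D}}}(\{\phi_0,\ldots,\phi_k\}\{\phi_n\})$ is the informativity of the deduction consisting of the support only: premisses $\phi_0,\ldots,\phi_k$ and conclusion $\phi_n$.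
   Formalization: In (iii) the symbols not in S must occur in a premiss or the conclusion (for the deduction p, q, p with only q not over S, the claim fails); database structures may interpret function symbols by incomplete graphs, since single-tuple insertions cannot keep them total. *)

theory Defs
  imports Complex_Main "HOL-Library.Infinite_Typeclass"
begin

section \<open>First-order syntax\<close>

text \<open>
  Symbols carry their kind and number of arguments.  Updates act on the set of tuples that
  interprets a symbol, so the arity of a symbol is the length of those tuples; a function symbol
  with \<open>m\<close> arguments is interpreted by its graph and so has arity \<open>m + 1\<close>.
\<close>

datatype 's symbol = Cst 's | Rel 's nat | Fun 's nat

primrec arity :: "'s symbol \<Rightarrow> nat" where
  "arity (Cst c) = 0"
| "arity (Rel r n) = n"
| "arity (Fun f m) = Suc m"

definition signature :: "'s symbol set \<Rightarrow> bool" where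
  "signature S \<longleftrightarrow> (\<forall>r. Rel r 0 \<notin> S) \<and> (\<forall>f. Fun f 0 \<notin> S)"

datatype 's tm = Var nat | Con 's | App 's "'s tm list"

datatype 's form =
    Pred 's "'s tm list"
  | Eq "'s tm" "'s tm"
  | Neg "'s form"
  | Conj "'s form" "'s form"
  | Disj "'s form" "'s form"
  | Imp "'s form" "'s form"
  | All nat "'s form"
  | Ex nat "'s form"

primrec fv_tm :: "'s tm \<Rightarrow> nat set" where
  "fv_tm (Var x) = {x}"
| "fv_tm (Con c) = {}"
| "fv_tm (App f ts) = \<Union> (set (map fv_tm ts))"

primrec fv :: "'s form \<Rightarrow> nat set" where
  "fv (Pred r ts) = \<Union> (fv_tm ` set ts)"
| "fv (Eq s t) = fv_tm s \<union> fv_tm t"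
| "fv (Neg p) = fv p"
| "fv (Conj p q) = fv p \<union> fv q"
| "fv (Disj p q) = fv p \<union> fv q"
| "fv (Imp p q) = fv p \<union> fv q"
| "fv (All x p) = fv p - {x}"
| "fv (Ex x p) = fv p - {x}"

primrec syms_tm :: "'s tm \<Rightarrow> 's symbol set" where
  "syms_tm (Var x) = {}"
| "syms_tm (Con c) = {Cst c}"
| "syms_tm (App f ts) = insert (Fun f (length ts)) (\<Union> (set (map syms_tm ts)))"

primrec syms :: "'s form \<Rightarrow> 's symbol set" where
  "syms (Pred r ts) = insert (Rel r (length ts)) (\<Union> (syms_tm ` set ts))"
| "syms (Eq s t) = syms_tm s \<union> syms_tm t"
| "syms (Neg p) = syms p"
| "syms (Conj p q) = syms p \<union> syms q"
| "syms (Disj p q) = syms p \<union> syms q"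
| "syms (Imp p q) = syms p \<union> syms q"
| "syms (All x p) = syms p"
| "syms (Ex x p) = syms p"

definition is_proposition :: "'s form \<Rightarrow> bool" where
  "is_proposition p \<longleftrightarrow> fv p = {} \<and> signature (syms p)"

section \<open>Structures and truth\<close>

text \<open>
  The values of \<open>con\<close> and \<open>rel\<close> are meaningful only at the constants, respectively the symbols of
  positive arity, that belong to \<open>sig\<close>.
\<close>

record ('s, 'a) struct =
  sig :: "'s symbol set"
  universe :: "'a set"
  con :: "'s symbol \<Rightarrow> 'a"
  rel :: "'s symbol \<Rightarrow> 'a list set"

definition same_interp :: "('s, 'a) struct \<Rightarrow> ('s, 'a) struct \<Rightarrow> 's symbol \<Rightarrow> bool" where
  "same_interp A B \<tau> \<longleftrightarrow>
     (if arity \<tau> = 0 then con A \<tau> = con B \<tau> else rel A \<tau> = rel B \<tau>)"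

text \<open>
  Insertions and deletions change an interpretation one tuple at a time, and may enlarge the
  domain while leaving the other interpretations alone, so the graph of a function symbol
  can be incomplete at the intermediate stages of an update.  A structure therefore interprets a
  function symbol by a single-valued set of tuples that need not be total.  An incomplete graph
  does not interpret the symbol in sentences: truth of a sentence requires the graphs of all
  its function symbols to be total, and its semantics is then the classical one.
  Logical consequence refers to structures all of whose function symbols are total, that is, to
  first-order structures in the usual sense.
\<close>

definition is_structure :: "('s, 'a) struct \<Rightarrow> bool" where
  "is_structure A \<longleftrightarrow>
     signature (sig A) \<and> universe A \<noteq> {} \<and>
     (\<forall>\<sigma>\<in>sig A. arity \<sigma> = 0 \<longrightarrow> con A \<sigma> \<in> universe A) \<and>
     (\<forall>\<sigma>\<in>sig A. arity \<sigma> > 0 \<longrightarrow>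
        rel A \<sigma> \<subseteq> {as. length as = arity \<sigma> \<and> set as \<subseteq> universe A}) \<and>
     (\<forall>f m as b b'. Fun f m \<in> sig A \<longrightarrow> as @ [b] \<in> rel A (Fun f m) \<longrightarrow>
        as @ [b'] \<in> rel A (Fun f m) \<longrightarrow> b = b')"

definition total_on_funs :: "('s, 'a) struct \<Rightarrow> 's symbol set \<Rightarrow> bool" where
  "total_on_funs A S \<longleftrightarrow>
     (\<forall>f m as. Fun f m \<in> S \<longrightarrow> length as = m \<longrightarrow> set as \<subseteq> universe A \<longrightarrow>
        (\<exists>b. as @ [b] \<in> rel A (Fun f m)))"

definition interprets :: "('s, 'a) struct \<Rightarrow> 's form \<Rightarrow> bool" where
  "interprets A p \<longleftrightarrow> syms p \<subseteq> sig A \<and> total_on_funs A (syms p)"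

primrec tm_val :: "('s, 'a) struct \<Rightarrow> (nat \<Rightarrow> 'a) \<Rightarrow> 's tm \<Rightarrow> 'a" where
  "tm_val A e (Var x) = e x"
| "tm_val A e (Con c) = con A (Cst c)"
| "tm_val A e (App f ts) = (THE b. map (tm_val A e) ts @ [b] \<in> rel A (Fun f (length ts)))"

primrec sat :: "('s, 'a) struct \<Rightarrow> (nat \<Rightarrow> 'a) \<Rightarrow> 's form \<Rightarrow> bool" where
  "sat A e (Pred r ts) \<longleftrightarrow> map (tm_val A e) ts \<in> rel A (Rel r (length ts))"
| "sat A e (Eq s t) \<longleftrightarrow> tm_val A e s = tm_val A e t"
| "sat A e (Neg p) \<longleftrightarrow> \<not> sat A e p"
| "sat A e (Conj p q) \<longleftrightarrow> sat A e p \<and> sat A e q"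
| "sat A e (Disj p q) \<longleftrightarrow> sat A e p \<or> sat A e q"
| "sat A e (Imp p q) \<longleftrightarrow> (sat A e p \<longrightarrow> sat A e q)"
| "sat A e (All x p) \<longleftrightarrow> (\<forall>a\<in>universe A. sat A (e(x := a)) p)"
| "sat A e (Ex x p) \<longleftrightarrow> (\<exists>a\<in>universe A. sat A (e(x := a)) p)"

definition true_in :: "('s, 'a) struct \<Rightarrow> 's form \<Rightarrow> bool" where
  "true_in A p \<longleftrightarrow> interprets A p \<and> (\<forall>e. range e \<subseteq> universe A \<longrightarrow> sat A e p)"

text \<open>
  Consequence relative to the signature \<open>S\<close>: the models are the structures over \<open>S\<close>, so a
  sentence with a symbol outside \<open>S\<close> is not a consequence of a consistent theory over \<open>S\<close>, even
  if it is logically valid.  Domains range over all nonempty sets of objects of type \<open>'a\<close>; for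
  infinite \<open>'a\<close> and finite \<open>\<Gamma>\<close> this agrees with consequence over arbitrary
  domains, by the Loewenheim-Skolem theorem.
\<close>

definition entails :: "'a itself \<Rightarrow> 's symbol set \<Rightarrow> 's form set \<Rightarrow> 's form \<Rightarrow> bool" where
  "entails _ S \<Gamma> p \<longleftrightarrow>
     (\<forall>A :: ('s, 'a) struct.
        is_structure A \<and> sig A = S \<and> total_on_funs A S \<and> (\<forall>q\<in>\<Gamma>. true_in A q) \<longrightarrow> true_in A p)"

section \<open>Databases, insertions, deletions and updates\<close>

type_synonym ('s, 'a) database = "('s, 'a) struct \<times> 's form set"

definition database :: "'s symbol set \<Rightarrow> ('s, 'a) database \<Rightarrow> bool" where
  "database S D \<longleftrightarrow> (case D of (A, T) \<Rightarrow>
     is_structure A \<and> sig A = S \<and> finite (universe A) \<and>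
     finite T \<and> (\<forall>p\<in>T. is_proposition p \<and> syms p \<subseteq> S \<and> true_in A p))"

definition insertion ::
    "'s symbol \<Rightarrow> ('s, 'a) database \<Rightarrow> ('s, 'a) database \<Rightarrow> bool" where
  "insertion \<sigma> D D' \<longleftrightarrow> (case (D, D') of ((A, T), (A', T')) \<Rightarrow>
     T' = T \<and> database (insert \<sigma> (sig A)) D' \<and>
     (\<forall>\<tau>\<in>sig A. \<tau> \<noteq> \<sigma> \<longrightarrow> same_interp A' A \<tau>) \<and>
     (arity \<sigma> = 0 \<longrightarrow> \<sigma> \<in> sig A \<longrightarrow> universe A' = universe A \<and> con A' \<sigma> = con A \<sigma>) \<and>
     (arity \<sigma> = 0 \<longrightarrow> \<sigma> \<notin> sig A \<longrightarrow>
        (\<exists>a. universe A' = insert a (universe A) \<and> con A' \<sigma> = a)) \<and>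
     (arity \<sigma> > 0 \<longrightarrow>
        (\<exists>as. length as = arity \<sigma> \<and> universe A' = universe A \<union> set as \<and>
              rel A' \<sigma> = insert as (if \<sigma> \<in> sig A then rel A \<sigma> else {}))))"

definition free_for :: "('s, 'a) struct \<Rightarrow> 's symbol \<Rightarrow> 'a \<Rightarrow> bool" where
  "free_for A \<sigma> a \<longleftrightarrow>
     \<not> (\<exists>\<tau>\<in>sig A. arity \<tau> = 0 \<and> \<tau> \<noteq> \<sigma> \<and> con A \<tau> = a) \<and>
     \<not> (\<exists>\<delta>\<in>sig A. arity \<delta> > 0 \<and> \<delta> \<noteq> \<sigma> \<and> (\<exists>bs\<in>rel A \<delta>. a \<in> set bs))"

definition deletion ::
    "'s symbol \<Rightarrow> ('s, 'a) database \<Rightarrow> ('s, 'a) database \<Rightarrow> bool" where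
  "deletion \<sigma> D D' \<longleftrightarrow> (case (D, D') of ((A, T), (A', T')) \<Rightarrow>
     \<sigma> \<in> sig A \<and> T' = T \<and>
     (sig A' = sig A \<or> sig A' = sig A - {\<sigma>}) \<and> database (sig A') D' \<and>
     (\<forall>\<tau>\<in>sig A - {\<sigma>}. same_interp A' A \<tau>) \<and>
     (arity \<sigma> = 0 \<longrightarrow> sig A' = sig A \<longrightarrow>
        universe A' = universe A \<and> (\<exists>a\<in>universe A. a \<noteq> con A \<sigma> \<and> con A' \<sigma> = a)) \<and>
     (arity \<sigma> = 0 \<longrightarrow> sig A' = sig A - {\<sigma>} \<longrightarrow>
        universe A' = (if free_for A \<sigma> (con A \<sigma>)
                       then universe A - {con A \<sigma>} else universe A)) \<and>
     (arity \<sigma> > 0 \<longrightarrow> sig A' = sig A \<longrightarrow>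
        universe A' = universe A \<and>
        (\<exists>as. length as = arity \<sigma> \<and> rel A' \<sigma> = rel A \<sigma> - {as})) \<and>
     (arity \<sigma> > 0 \<longrightarrow> sig A' = sig A - {\<sigma>} \<longrightarrow>
        (\<exists>C. finite C \<and> (\<forall>c\<in>C. (\<exists>as\<in>rel A \<sigma>. c \<in> set as) \<and> free_for A \<sigma> c) \<and>
             universe A' = universe A - C)))"

text \<open>
  A sequence \<open>(D\<^sub>i : i < \<alpha>)\<close> with \<open>0 < \<alpha> \<le> \<omega>\<close> is a partial function on the naturals with domain
  \<open>\<alpha>\<close>: either \<open>{..n}\<close> (that is, \<open>\<alpha> = n + 1\<close>) or everything.
\<close>

type_synonym ('s, 'a) update = "nat \<rightharpoonup> ('s, 'a) database"

definition update :: "('s, 'a) database \<Rightarrow> ('s, 'a) update \<Rightarrow> bool" where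
  "update D U \<longleftrightarrow>
     (dom U = UNIV \<or> (\<exists>n. dom U = {..n})) \<and> U 0 = Some D \<and>
     (\<forall>i. Suc i \<in> dom U \<longrightarrow>
        (\<exists>\<sigma>. insertion \<sigma> (the (U i)) (the (U (Suc i))) \<or>
             deletion \<sigma> (the (U i)) (the (U (Suc i)))))"

definition stage :: "('s, 'a) update \<Rightarrow> nat \<Rightarrow> ('s, 'a) struct" where
  "stage U i = fst (the (U i))"

definition satisfactory :: "('s, 'a) update \<Rightarrow> 's form \<Rightarrow> bool" where
  "satisfactory U p \<longleftrightarrow> (\<exists>n. dom U = {..n} \<and> true_in (stage U n) p)"

definition upd_norm :: "('s, 'a) update \<Rightarrow> 's form \<Rightarrow> nat" where
  "upd_norm U p = (LEAST i. i \<in> dom U \<and> true_in (stage U i) p)"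

section \<open>Deductions and semantic informativity\<close>

text \<open>
  A deduction is a list of propositions \<open>\<phi>\<^sub>0, \<dots>, \<phi>\<^sub>n\<close> together with the index \<open>k \<le> n\<close> of its last
  premiss.
\<close>

definition deduction :: "'s form list \<Rightarrow> nat \<Rightarrow> bool" where
  "deduction ps k \<longleftrightarrow> k < length ps \<and> (\<forall>p\<in>set ps. is_proposition p)"

definition premisses :: "'s form list \<Rightarrow> nat \<Rightarrow> 's form list" where
  "premisses ps k = take (Suc k) ps"

definition support :: "'s form list \<Rightarrow> nat \<Rightarrow> 's form set" where
  "support ps k = set (premisses ps k) \<union> {last ps}"

definition support_deduction :: "'s form list \<Rightarrow> nat \<Rightarrow> 's form list" where
  "support_deduction ps k = premisses ps k @ [last ps]"

definition valid_deduction :: "'a itself \<Rightarrow> 's form list \<Rightarrow> nat \<Rightarrow> bool" where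
  "valid_deduction ty ps k \<longleftrightarrow>
     deduction ps k \<and>
     entails ty (\<Union> (syms ` support ps k)) (set (premisses ps k)) (last ps)"

definition conditional :: "'s form list \<Rightarrow> nat \<Rightarrow> 's form" where
  "conditional ps k =
     Imp (foldl Conj (hd (premisses ps k)) (tl (premisses ps k))) (last ps)"

definition complexity :: "('s, 'a) update set \<Rightarrow> 's form \<Rightarrow> nat" where
  "complexity \<U> p =
     (if \<exists>U\<in>\<U>. satisfactory U p
      then LEAST m. \<exists>U\<in>\<U>. satisfactory U p \<and> upd_norm U p = m
      else 0)"

definition complexity_deduction :: "('s, 'a) update set \<Rightarrow> 's form list \<Rightarrow> nat" where
  "complexity_deduction \<U> ps = (\<Sum>p\<in>set ps. complexity \<U> p)"

text \<open>Here \<open>T\<close> and the signature are those of the database \<open>U 0\<close> that \<open>U\<close> updates.\<close>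

definition relevant :: "('s, 'a) update \<Rightarrow> 's form set \<Rightarrow> 's form set" where
  "relevant U \<Gamma> =
     {p \<in> \<Gamma>. satisfactory U p \<and> \<not> entails TYPE('a) (sig (stage U 0)) (snd (the (U 0))) p}"

text \<open>Among several satisfactory updates of the same least length an arbitrary one is chosen.\<close>

definition smallest_update :: "('s, 'a) update set \<Rightarrow> 's form \<Rightarrow> ('s, 'a) update" where
  "smallest_update \<U> p = (ARG_MIN (\<lambda>U. card (dom U)) U. U \<in> \<U> \<and> satisfactory U p)"

definition relevancy :: "('s, 'a) update set \<Rightarrow> 's form list \<Rightarrow> nat \<Rightarrow> real" where
  "relevancy \<U> ps k =
     (if valid_deduction TYPE('a) ps k \<and> (\<exists>U\<in>\<U>. satisfactory U (last ps))
      then real (card (relevant (smallest_update \<U> (last ps)) (support ps k))) /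
           real (card (support ps k))
      else 0)"

definition informativity :: "('s, 'a) update set \<Rightarrow> 's form list \<Rightarrow> nat \<Rightarrow> real" where
  "informativity \<U> ps k = real (complexity_deduction \<U> ps) * relevancy \<U> ps k"

definition informativity_prop :: "('s, 'a) update set \<Rightarrow> 's form \<Rightarrow> real" where
  "informativity_prop \<U> p = informativity \<U> [p] 0"

end

theory Submission
  imports Defs
begin

text \<open>
  Truth of a sentence depends only on the universe and on the interpretation of its own symbols.
  Hence the conditional of a valid deduction holds in every structure that interprets it: it is a
  consequence of every theory whose signature contains its symbols, and so nothing in its support
  is relevant there.  If it has a symbol outside \<open>S\<close>, it is false in \<open>D\<close> and not a consequence
  of the theory over \<open>S\<close>, but it becomes true once the missing symbols are interpreted.  That
  can be done by finitely many insertions over the old universe, completing the graphs of the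
  function symbols point by point.  The theory is preserved all along, because its function
  symbols have total graphs from the start.
\<close>

section \<open>Coincidence\<close>

text \<open>Values of \<open>con\<close> and \<open>rel\<close> are compared at every symbol of
  \<open>F\<close> whatever its kind, and the signatures are left out, so that one notion serves
  reducts and expansions alike.\<close>

definition agree_on :: "('s, 'a) struct \<Rightarrow> ('s, 'a) struct \<Rightarrow> 's symbol set \<Rightarrow> bool" where
  "agree_on A B F \<longleftrightarrow>
     universe A = universe B \<and> (\<forall>\<sigma>\<in>F. con A \<sigma> = con B \<sigma> \<and> rel A \<sigma> = rel B \<sigma>)"

lemma agree_on_mono: "agree_on A B G \<Longrightarrow> F \<subseteq> G \<Longrightarrow> agree_on A B F"
  by (auto simp: agree_on_def)

lemma agree_on_trans: "agree_on A B F \<Longrightarrow> agree_on B C F \<Longrightarrow> agree_on A C F"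
  by (auto simp: agree_on_def)

lemma tm_val_cong:
  assumes "agree_on A B (syms_tm t)" "\<And>x. x \<in> fv_tm t \<Longrightarrow> e x = e' x"
  shows "tm_val A e t = tm_val B e' t"
  using assms
proof (induction t)
  case (App f ts)
  have "map (tm_val A e) ts = map (tm_val B e') ts"
  proof (rule map_cong[OF refl])
    fix t assume t: "t \<in> set ts"
    show "tm_val A e t = tm_val B e' t"
    proof (rule App.IH[OF t])
      show "agree_on A B (syms_tm t)"
        using App.prems(1) t by (auto intro: agree_on_mono)
      show "e x = e' x" if "x \<in> fv_tm t" for x
        using that t App.prems(2) by auto
    qed
  qed
  \<comment> \<open>The description in \<open>tm_val\<close> depends only on the argument values and
    the graph, so the two sides are equal even where the graph has no value.\<close>
  moreover have "rel A (Fun f (length ts)) = rel B (Fun f (length ts))"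
    using App.prems(1) by (simp add: agree_on_def)
  ultimately show ?case
    by (simp only: tm_val.simps)
qed (auto simp: agree_on_def)

lemma sat_cong:
  assumes "agree_on A B (syms p)" "\<And>x. x \<in> fv p \<Longrightarrow> e x = e' x"
  shows "sat A e p \<longleftrightarrow> sat B e' p"
  using assms
proof (induction p arbitrary: e e')
  case (Pred r ts)
  have "map (tm_val A e) ts = map (tm_val B e') ts"
  proof (rule map_cong[OF refl], rule tm_val_cong)
    fix t assume t: "t \<in> set ts"
    show "agree_on A B (syms_tm t)"
      using Pred.prems(1) t by (auto intro: agree_on_mono)
    show "e x = e' x" if "x \<in> fv_tm t" for x
      using that t Pred.prems(2) by auto
  qed
  moreover have "rel A (Rel r (length ts)) = rel B (Rel r (length ts))"
    using Pred.prems(1) by (simp add: agree_on_def)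
  ultimately show ?case
    by (simp only: sat.simps)
next
  case (Eq s t)
  have "tm_val A e s = tm_val B e' s" "tm_val A e t = tm_val B e' t"
    using Eq.prems by (auto intro!: tm_val_cong intro: agree_on_mono)
  then show ?case by simp
next
  case (Neg p)
  have "sat A e p \<longleftrightarrow> sat B e' p"
    using Neg.prems by (intro Neg.IH) auto
  then show ?case by simp
next
  case (Conj p q)
  have "sat A e p \<longleftrightarrow> sat B e' p" "sat A e q \<longleftrightarrow> sat B e' q"
    using Conj.prems by (auto intro!: Conj.IH intro: agree_on_mono)
  then show ?case by simp
next
  case (Disj p q)
  have "sat A e p \<longleftrightarrow> sat B e' p" "sat A e q \<longleftrightarrow> sat B e' q"
    using Disj.prems by (auto intro!: Disj.IH intro: agree_on_mono)
  then show ?case by simp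
next
  case (Imp p q)
  have "sat A e p \<longleftrightarrow> sat B e' p" "sat A e q \<longleftrightarrow> sat B e' q"
    using Imp.prems by (auto intro!: Imp.IH intro: agree_on_mono)
  then show ?case by simp
next
  case (All x p)
  have "sat A (e(x := a)) p \<longleftrightarrow> sat B (e'(x := a)) p" for a
    using All.prems by (intro All.IH) auto
  then show ?case
    using All.prems(1) by (simp add: agree_on_def)
next
  case (Ex x p)
  have "sat A (e(x := a)) p \<longleftrightarrow> sat B (e'(x := a)) p" for a
    using Ex.prems by (intro Ex.IH) auto
  then show ?case
    using Ex.prems(1) by (simp add: agree_on_def)
qed

lemma agree_on_reduct: "agree_on A (A\<lparr>sig := F\<rparr>) G"
  by (simp add: agree_on_def)

lemma agree_on_total:
  assumes "agree_on A B F" "total_on_funs A F"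
  shows "total_on_funs B F"
  unfolding total_on_funs_def
proof (intro allI impI)
  fix f m and as
  assume *: "Fun f m \<in> F" "length as = m" "set as \<subseteq> universe B"
  then have "rel A (Fun f m) = rel B (Fun f m)" "universe A = universe B"
    using assms(1) by (auto simp: agree_on_def)
  then show "\<exists>b. as @ [b] \<in> rel B (Fun f m)"
    using * assms(2) by (metis total_on_funs_def)
qed

lemma total_on_funs_mono: "total_on_funs A G \<Longrightarrow> F \<subseteq> G \<Longrightarrow> total_on_funs A F"
  unfolding total_on_funs_def by blast

text \<open>The signature of \<open>B\<close> may be larger or smaller than that of \<open>A\<close>
  as long as it contains the symbols of \<open>p\<close>; this lets the theory survive insertions of
  symbols that do not occur in it.\<close>

lemma true_in_agree:
  assumes "agree_on A B (syms p)" "syms p \<subseteq> sig B" "true_in A p"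
  shows "true_in B p"
  unfolding true_in_def interprets_def
proof (intro conjI allI impI)
  show "total_on_funs B (syms p)"
    using assms by (auto simp: true_in_def interprets_def intro: agree_on_total)
  fix e :: "nat \<Rightarrow> 'b" assume "range e \<subseteq> universe B"
  then have "range e \<subseteq> universe A"
    using assms(1) by (simp add: agree_on_def)
  then have "sat A e p"
    using assms(3) by (simp add: true_in_def)
  then show "sat B e p"
    using sat_cong[OF assms(1)] by blast
qed (use assms in auto)

text \<open>A sentence has no free variables, so its value is the same under every assignment and
  one assignment decides its truth.\<close>

lemma sat_imp_true_in:
  assumes "fv p = {}" "interprets A p" "sat A e p"
  shows "true_in A p"
proof -
  have "sat A e' p" for e'
    using sat_cong[of A A p e e'] assms by (simp add: agree_on_def)
  then show ?thesis
    using assms by (simp add: true_in_def)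
qed

section \<open>The conditional of a valid deduction\<close>

lemma sat_foldl_Conj: "sat A e (foldl Conj p qs) \<longleftrightarrow> (\<forall>q\<in>set (p # qs). sat A e q)"
  by (induction qs arbitrary: p) auto

lemma syms_foldl_Conj: "syms (foldl Conj p qs) = \<Union> (syms ` set (p # qs))"
  by (induction qs arbitrary: p) auto

lemma fv_foldl_Conj: "fv (foldl Conj p qs) = \<Union> (fv ` set (p # qs))"
  by (induction qs arbitrary: p) auto

text \<open>Since \<open>k < length ps\<close>, there is at least one premiss, so \<open>hd\<close>
  in \<open>conditional\<close> is a genuine premiss and not a default value.\<close>

lemma premisses_Cons:
  assumes "deduction ps k"
  shows "hd (premisses ps k) # tl (premisses ps k) = premisses ps k"
  using assms by (intro list.collapse) (auto simp: deduction_def premisses_def)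

lemma support_subset: "deduction ps k \<Longrightarrow> support ps k \<subseteq> set ps"
  using set_take_subset[of "Suc k" ps]
  by (cases "ps = []") (auto simp: deduction_def support_def premisses_def)

lemma sat_conditional:
  assumes "deduction ps k"
  shows "sat A e (conditional ps k) \<longleftrightarrow>
    ((\<forall>q\<in>set (premisses ps k). sat A e q) \<longrightarrow> sat A e (last ps))"
  by (simp only: conditional_def sat.simps sat_foldl_Conj premisses_Cons[OF assms])

lemma syms_conditional:
  assumes "deduction ps k"
  shows "syms (conditional ps k) = \<Union> (syms ` support ps k)"
  by (simp only: conditional_def syms.simps syms_foldl_Conj premisses_Cons[OF assms] support_def)
    auto

lemma fv_conditional:
  assumes "deduction ps k"
  shows "fv (conditional ps k) = \<Union> (fv ` support ps k)"
  by (simp only: conditional_def fv.simps fv_foldl_Conj premisses_Cons[OF assms] support_def)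
    auto

lemma is_proposition_conditional:
  assumes "deduction ps k"
  shows "is_proposition (conditional ps k)"
  using assms support_subset[OF assms]
  unfolding is_proposition_def fv_conditional[OF assms] syms_conditional[OF assms]
  by (auto simp: deduction_def is_proposition_def signature_def)

text \<open>Validity of a deduction only speaks of structures whose signature is exactly the symbols
  of its support, so arbitrary structures have to be cut down to these.\<close>

lemma is_structure_reduct:
  assumes "is_structure A" "F \<subseteq> sig A"
  shows "is_structure (A\<lparr>sig := F\<rparr>)"
  unfolding is_structure_def
proof (intro conjI ballI impI)
  show "rel (A\<lparr>sig := F\<rparr>) \<sigma> \<subseteq> {as. length as = arity \<sigma> \<and> set as \<subseteq> universe (A\<lparr>sig := F\<rparr>)}"
    if "\<sigma> \<in> sig (A\<lparr>sig := F\<rparr>)" "arity \<sigma> > 0" for \<sigma>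
  proof -
    have "rel A \<sigma> \<subseteq> {as. length as = arity \<sigma> \<and> set as \<subseteq> universe A}"
      using assms(1) that subsetD[OF assms(2), of \<sigma>] unfolding is_structure_def by simp
    then show ?thesis by simp
  qed
  show "\<forall>f m as b b'. Fun f m \<in> sig (A\<lparr>sig := F\<rparr>) \<longrightarrow>
    as @ [b] \<in> rel (A\<lparr>sig := F\<rparr>) (Fun f m) \<longrightarrow>
    as @ [b'] \<in> rel (A\<lparr>sig := F\<rparr>) (Fun f m) \<longrightarrow> b = b'"
    using assms by (auto simp: is_structure_def)
qed (use assms in \<open>auto simp: is_structure_def signature_def\<close>)

text \<open>Validity is applied to the reduct \<open>?B\<close> to the symbols of the support, and
  satisfaction is then carried back to \<open>A\<close> by coincidence.\<close>

lemma true_in_conditional: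
  fixes A :: "('s, 'a) struct"
  assumes valid: "valid_deduction TYPE('a) ps k" and A: "is_structure A"
    and int: "interprets A (conditional ps k)"
  shows "true_in A (conditional ps k)"
  unfolding true_in_def
proof (intro conjI allI impI int)
  let ?F = "\<Union> (syms ` support ps k)"
  let ?B = "A\<lparr>sig := ?F\<rparr>"
  have ded: "deduction ps k"
    using valid by (simp add: valid_deduction_def)
  have F: "?F \<subseteq> sig A" "total_on_funs A ?F"
    using int by (simp_all add: interprets_def syms_conditional[OF ded])
  fix e :: "nat \<Rightarrow> 'a" assume e: "range e \<subseteq> universe A"
  show "sat A e (conditional ps k)"
    unfolding sat_conditional[OF ded]
  proof
    assume prems: "\<forall>q\<in>set (premisses ps k). sat A e q"
    have B: "is_structure ?B" "total_on_funs ?B ?F"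
      using is_structure_reduct[OF A F(1)] agree_on_total[OF agree_on_reduct F(2)] by auto
    \<comment> \<open>The premisses are sentences, so satisfaction under the single assignment
      \<open>e\<close> already makes them true in the reduct.\<close>
    have "true_in ?B q" if q: "q \<in> set (premisses ps k)" for q
    proof (rule sat_imp_true_in)
      have sup: "q \<in> support ps k"
        using q by (simp add: support_def)
      then have "q \<in> set ps"
        using support_subset[OF ded] by blast
      then show "fv q = {}"
        using ded by (simp add: deduction_def is_proposition_def)
      have "syms q \<subseteq> ?F"
        using sup by blast
      then show "interprets ?B q"
        using total_on_funs_mono[OF B(2)] by (simp add: interprets_def)
      show "sat ?B e q"
        using prems q sat_cong[OF agree_on_reduct[of A ?F], of q e e] by simp
    qed
    then have "true_in ?B (last ps)"
      using valid B by (simp add: valid_deduction_def entails_def)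
    then have "sat ?B e (last ps)"
      using e by (simp add: true_in_def)
    then show "sat A e (last ps)"
      using sat_cong[OF agree_on_reduct[of A ?F], of "last ps" e e] by simp
  qed
qed

text \<open>The models in \<open>entails\<close> have total graphs for all function symbols of
  \<open>S\<close>, so they interpret the conditional, which then holds there whatever
  \<open>T\<close> says.\<close>

lemma entails_conditional:
  assumes "valid_deduction TYPE('a) ps k" "syms (conditional ps k) \<subseteq> S"
  shows "entails TYPE('a) S T (conditional ps k)"
  unfolding entails_def
  using assms by (auto intro!: true_in_conditional simp: interprets_def intro: total_on_funs_mono)

section \<open>Vanishing informativity over the given signature\<close>

lemma smallest_update_satisfactory:
  assumes "U \<in> \<U>" "satisfactory U p"
  shows "smallest_update \<U> p \<in> \<U> \<and> satisfactory (smallest_update \<U> p) p"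
  unfolding smallest_update_def
  using arg_min_natI[of "\<lambda>U. U \<in> \<U> \<and> satisfactory U p" U "\<lambda>U. card (dom U)"] assms by blast

text \<open>The factor \<open>relevancy\<close> vanishes: either no update is satisfactory, or the
  conditional is the whole support and is excluded from \<open>relevant\<close> as a consequence of
  the theory.\<close>

lemma informativity_conditional_eq_0:
  fixes D :: "('s, 'a) database"
  assumes "database S D" "\<forall>U\<in>\<U>. update D U" "valid_deduction TYPE('a) ps k"
    "\<forall>p\<in>set ps. syms p \<subseteq> S"
  shows "informativity_prop \<U> (conditional ps k) = 0"
proof -
  let ?p = "conditional ps k"
  have ded: "deduction ps k"
    using assms(3) by (simp add: valid_deduction_def)
  have "syms ?p \<subseteq> S"
    using assms(4) support_subset[OF ded] by (auto simp: syms_conditional[OF ded])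
  then have ent: "entails TYPE('a) S T ?p" for T
    using assms(3) by (rule entails_conditional[rotated])
  have "relevant (smallest_update \<U> ?p) {?p} = {}" if "U \<in> \<U>" "satisfactory U ?p" for U
  proof -
    \<comment> \<open>\<open>relevant\<close> tests consequence over the signature of stage 0, which
      is that of \<open>D\<close> because the chosen update belongs to the collection.\<close>
    have "update D (smallest_update \<U> ?p)"
      using smallest_update_satisfactory[OF that] assms(2) by blast
    then have "sig (stage (smallest_update \<U> ?p) 0) = S"
      using assms(1) by (auto simp: update_def stage_def database_def split: prod.splits)
    then show ?thesis
      using ent by (simp add: relevant_def)
  qed
  then show ?thesis
    by (auto simp: informativity_prop_def informativity_def relevancy_def support_def premisses_def)
qed

section \<open>Updates by insertions\<close>

text \<open>With this relation finite updates become paths, which are composed by transitivity of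
  \<open>step\<^sup>*\<^sup>*\<close>.\<close>

definition step :: "('s, 'a) database \<Rightarrow> ('s, 'a) database \<Rightarrow> bool" where
  "step D D' \<longleftrightarrow> (\<exists>\<sigma>. insertion \<sigma> D D' \<or> deletion \<sigma> D D')"

lemma update_of_steps:
  fixes D :: "('s, 'a) database"
  assumes "step\<^sup>*\<^sup>* D D'"
  shows "\<exists>U n. update D U \<and> dom U = {..n} \<and> U n = Some D'"
  using assms
proof induction
  case base
  let ?U = "[0 \<mapsto> D] :: ('s, 'a) update"
  have "update D ?U \<and> dom ?U = {..0} \<and> ?U 0 = Some D"
    by (auto simp: update_def)
  then show ?case by blast
next
  case (step D' D'')
  then obtain U n where U: "update D U" "dom U = {..n}" "U n = Some D'" by blast
  let ?V = "U(Suc n \<mapsto> D'')"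
  have dom: "dom ?V = {..Suc n}"
    using U(2) by (auto simp: atMost_Suc)
  \<comment> \<open>Only the transition at \<open>i = n\<close> is new; all others lie within
    \<open>U\<close>.\<close>
  have "step (the (?V i)) (the (?V (Suc i)))" if "Suc i \<in> dom ?V" for i
  proof (cases "i = n")
    case True
    then show ?thesis using U(3) step.hyps(2) by simp
  next
    case False
    then have "Suc i \<in> dom U" "i \<noteq> Suc n"
      using that dom U(2) by auto
    then show ?thesis
      using False U(1) by (simp add: update_def step_def)
  qed
  moreover have "?V 0 = Some D"
    using U(1) by (simp add: update_def)
  ultimately have "update D ?V"
    unfolding update_def step_def using dom by blast
  then show ?case using dom by auto
qed

text \<open>The theory only sees its own symbols and the universe, so an expansion that leaves these
  alone is again a database.\<close>

lemma database_agree: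
  assumes "database S (A, T)" "is_structure B" "S \<subseteq> sig B"
    "agree_on A B (\<Union> (syms ` T))"
  shows "database (sig B) (B, T)"
proof -
  have "true_in B p" if "p \<in> T" for p
    using assms that
    by (intro true_in_agree[of A B p]) (auto simp: database_def intro: agree_on_mono)
  moreover have "universe B = universe A"
    using assms(4) by (simp add: agree_on_def)
  moreover have "syms p \<subseteq> sig B" if "p \<in> T" for p
    using assms(1,3) that by (auto simp: database_def)
  ultimately show ?thesis
    using assms(1,2) by (simp add: database_def)
qed

section \<open>Single insertions over an unchanged universe\<close>

definition add_con :: "'s symbol \<Rightarrow> 'a \<Rightarrow> ('s, 'a) struct \<Rightarrow> ('s, 'a) struct" where
  "add_con \<sigma> a A = A\<lparr>sig := insert \<sigma> (sig A), con := (con A)(\<sigma> := a)\<rparr>"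

text \<open>The value stored in \<open>rel A\<close> at a symbol outside the signature is
  meaningless, so a new symbol starts from the empty set.\<close>

definition add_tuple :: "'s symbol \<Rightarrow> 'a list \<Rightarrow> ('s, 'a) struct \<Rightarrow> ('s, 'a) struct" where
  "add_tuple \<sigma> as A = A\<lparr>sig := insert \<sigma> (sig A),
     rel := (rel A)(\<sigma> := insert as (if \<sigma> \<in> sig A then rel A \<sigma> else {}))\<rparr>"

lemma sig_add_con [simp]: "sig (add_con \<sigma> a A) = insert \<sigma> (sig A)"
  by (simp add: add_con_def)

lemma sig_add_tuple [simp]: "sig (add_tuple \<sigma> as A) = insert \<sigma> (sig A)"
  by (simp add: add_tuple_def)

lemma agree_on_add_con: "\<sigma> \<notin> F \<Longrightarrow> agree_on A (add_con \<sigma> a A) F"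
  by (auto simp: agree_on_def add_con_def)

lemma agree_on_add_tuple: "\<sigma> \<notin> F \<Longrightarrow> agree_on A (add_tuple \<sigma> as A) F"
  by (auto simp: agree_on_def add_tuple_def)

lemma step_add_con:
  assumes db: "database S (A, T)" and \<sigma>: "arity \<sigma> = 0" "signature {\<sigma>}" "\<sigma> \<notin> S"
    and a: "a \<in> universe A"
  shows "step (A, T) (add_con \<sigma> a A, T)" "database (insert \<sigma> S) (add_con \<sigma> a A, T)"
proof -
  have A: "is_structure A" "sig A = S" "\<And>p. p \<in> T \<Longrightarrow> syms p \<subseteq> S"
    using db by (auto simp: database_def)
  have "is_structure (add_con \<sigma> a A)"
    using A(1) \<sigma> a unfolding is_structure_def add_con_def signature_def by auto
  then show db': "database (insert \<sigma> S) (add_con \<sigma> a A, T)"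
    using database_agree[OF db, of "add_con \<sigma> a A"] A(2,3) \<sigma>(3)
      agree_on_add_con[of \<sigma> "\<Union> (syms ` T)" A a]
    by auto
  have "insertion \<sigma> (A, T) (add_con \<sigma> a A, T)"
    using db' A(2) \<sigma> a by (auto simp: insertion_def same_interp_def add_con_def insert_absorb)
  then show "step (A, T) (add_con \<sigma> a A, T)"
    by (auto simp: step_def)
qed

text \<open>For a function symbol, \<open>butlast as\<close> is the argument tuple and
  \<open>last as\<close> its value; \<open>fresh\<close> says that no value is present there yet, so
  the graph stays single-valued.\<close>

lemma step_add_tuple:
  assumes db: "database S (A, T)" and \<sigma>: "arity \<sigma> > 0" "signature {\<sigma>}"
    "\<sigma> \<notin> \<Union> (syms ` T)"
    and as: "length as = arity \<sigma>" "set as \<subseteq> universe A"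
    and fresh: "\<And>f m b. \<sigma> = Fun f m \<Longrightarrow> \<sigma> \<in> S \<Longrightarrow> butlast as @ [b] \<notin> rel A \<sigma>"
  shows "step (A, T) (add_tuple \<sigma> as A, T)" "database (insert \<sigma> S) (add_tuple \<sigma> as A, T)"
proof -
  let ?B = "add_tuple \<sigma> as A"
  have A: "is_structure A" "sig A = S"
    using db by (auto simp: database_def)
  have single: "b = b'"
    if "Fun f m \<in> insert \<sigma> S" "cs @ [b] \<in> rel ?B (Fun f m)" "cs @ [b'] \<in> rel ?B (Fun f m)"
    for f m cs b b'
  proof (cases "Fun f m = \<sigma>")
    case True
    then show ?thesis
      using that(2,3) A fresh[of f m] unfolding is_structure_def add_tuple_def
      by (auto split: if_splits)
  next
    case False
    then show ?thesis
      using that A unfolding is_structure_def add_tuple_def by auto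
  qed
  have sub: "rel ?B \<tau> \<subseteq> {cs. length cs = arity \<tau> \<and> set cs \<subseteq> universe ?B}"
    if "\<tau> \<in> insert \<sigma> S" "arity \<tau> > 0" for \<tau>
    using that A as unfolding is_structure_def add_tuple_def by (cases "\<tau> = \<sigma>") auto
  have "is_structure ?B"
    unfolding is_structure_def
  proof (intro conjI allI ballI impI)
    show "signature (sig ?B)" "universe ?B \<noteq> {}"
      using A(1) \<sigma>(2) by (auto simp: is_structure_def add_tuple_def signature_def)
    show "con ?B \<tau> \<in> universe ?B" if "\<tau> \<in> sig ?B" "arity \<tau> = 0" for \<tau>
      using that A(1) \<sigma>(1) by (auto simp: is_structure_def add_tuple_def)
    show "rel ?B \<tau> \<subseteq> {cs. length cs = arity \<tau> \<and> set cs \<subseteq> universe ?B}"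
      if "\<tau> \<in> sig ?B" "arity \<tau> > 0" for \<tau>
      using that sub A(2) by simp
    show "b = b'" if "Fun f m \<in> sig ?B" "cs @ [b] \<in> rel ?B (Fun f m)"
      "cs @ [b'] \<in> rel ?B (Fun f m)" for f m cs b b'
      using that single A(2) by simp
  qed
  then show db': "database (insert \<sigma> S) (?B, T)"
    using database_agree[OF db, of ?B] A(2) agree_on_add_tuple[OF \<sigma>(3), of A as] by auto
  have "insertion \<sigma> (A, T) (?B, T)"
    using db' A(2) \<sigma>(1) as
    by (auto simp: insertion_def same_interp_def add_tuple_def intro!: exI[of _ as])
  then show "step (A, T) (?B, T)"
    by (auto simp: step_def)
qed

section \<open>Interpreting finitely many new symbols\<close>

lemma theory_funs_total:
  assumes "database S (A, T)"
  shows "total_on_funs A (\<Union> (syms ` T))"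
  using assms unfolding database_def true_in_def interprets_def total_on_funs_def by blast

text \<open>By induction on \<open>X\<close>, a missing value is inserted at one argument tuple
  after another. An empty \<open>X\<close> triggers no insertion, so \<open>new\<close> requires the
  symbol to be in \<open>S\<close> already in that case.\<close>

lemma steps_complete_fun:
  fixes A :: "('s, 'a) struct"
  assumes db: "database S (A, T)" and sg: "signature {Fun f m}" and "finite X"
    and X: "\<forall>as\<in>X. length as = m \<and> set as \<subseteq> universe A"
    and new: "X = {} \<Longrightarrow> Fun f m \<in> S"
  shows "\<exists>B. step\<^sup>*\<^sup>* (A, T) (B, T) \<and> database (insert (Fun f m) S) (B, T) \<and>
    agree_on A B (- {Fun f m}) \<and> (\<forall>as\<in>X. \<exists>b. as @ [b] \<in> rel B (Fun f m))"
  using \<open>finite X\<close> X new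
proof (induction X)
  case empty
  then show ?case
    using db by (auto simp: insert_absorb agree_on_def intro!: exI[of _ A])
next
  case (insert as X)
  let ?\<sigma> = "Fun f m"
  let ?good = "\<lambda>B S'. step\<^sup>*\<^sup>* (A, T) (B, T) \<and> database S' (B, T) \<and> insert ?\<sigma> S' = insert ?\<sigma> S
    \<and> agree_on A B (- {?\<sigma>}) \<and> (\<forall>as\<in>X. ?\<sigma> \<in> S' \<and> (\<exists>b. as @ [b] \<in> rel B ?\<sigma>))"
  obtain B S' where B: "?good B S'"
  proof (cases "X = {} \<and> ?\<sigma> \<notin> S")
    case True
    then have "?good A S"
      using db by (simp add: agree_on_def)
    then show thesis using that by blast
  next
    case False
    then have "\<exists>B. ?good B (insert ?\<sigma> S)"
      using insert.IH insert.prems by simp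
    then show thesis using that by blast
  qed
  then have steps: "step\<^sup>*\<^sup>* (A, T) (B, T)" and dbB: "database S' (B, T)"
    and S': "insert ?\<sigma> S' = insert ?\<sigma> S" and agree: "agree_on A B (- {?\<sigma>})"
    and val: "\<And>as. as \<in> X \<Longrightarrow> ?\<sigma> \<in> S' \<and> (\<exists>b. as @ [b] \<in> rel B ?\<sigma>)"
    by blast+
  have univ: "universe B = universe A" and sigB: "sig B = S'"
    using agree dbB by (simp_all add: agree_on_def database_def)
  have as: "length as = m" "set as \<subseteq> universe A"
    using insert.prems(1) by simp_all
  show ?case
  \<comment> \<open>A tuple stored in \<open>rel B\<close> counts as a value only once the symbol
    belongs to the signature.\<close>
  proof (cases "?\<sigma> \<in> S' \<and> (\<exists>b. as @ [b] \<in> rel B ?\<sigma>)")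
    case True
    then have "S' = insert ?\<sigma> S"
      using S' by (simp only: insert_absorb)
    then show ?thesis
      using True steps dbB agree val by (intro exI[of _ B]) blast
  next
    case False
    \<comment> \<open>A true theory has total graphs for its function symbols, so a symbol with a
      missing value cannot occur in it.\<close>
    have notT: "?\<sigma> \<notin> \<Union> (syms ` T)"
    proof
      assume \<sigma>: "?\<sigma> \<in> \<Union> (syms ` T)"
      then have "\<exists>b. as @ [b] \<in> rel B ?\<sigma>"
        using theory_funs_total[OF dbB] as univ unfolding total_on_funs_def by simp
      moreover have "?\<sigma> \<in> S'"
        using dbB \<sigma> by (auto simp: database_def)
      ultimately show False
        using False by blast
    qed
    obtain b where b: "b \<in> universe A"
      using db by (auto simp: database_def is_structure_def)
    let ?C = "add_tuple ?\<sigma> (as @ [b]) B"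
    have "butlast (as @ [b]) @ [c] \<notin> rel B ?\<sigma>" if "?\<sigma> \<in> S'" for c
      using that False by simp
    then have C: "step (B, T) (?C, T)" "database (insert ?\<sigma> S') (?C, T)"
      using as b univ by (intro step_add_tuple[OF dbB _ sg notT]; simp)+
    have "step\<^sup>*\<^sup>* (A, T) (?C, T)"
      using steps C(1) by (rule rtranclp.rtrancl_into_rtrancl)
    moreover have "database (insert ?\<sigma> S) (?C, T)"
      using C(2) S' by (simp only:)
    moreover have "agree_on A ?C (- {?\<sigma>})"
      by (rule agree_on_trans[OF agree agree_on_add_tuple]) simp
    moreover have "\<forall>cs\<in>insert as X. \<exists>b. cs @ [b] \<in> rel ?C ?\<sigma>"
      using val sigB by (auto simp: add_tuple_def)
    ultimately show ?thesis by blast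
  qed
qed

text \<open>At most one insertion is needed for a constant or a relation. For a function symbol the
  universe stays fixed and finite, so finitely many insertions fill the graph.\<close>

lemma steps_interpret_symbol:
  assumes db: "database S (A, T)" and sg: "signature {\<sigma>}"
  shows "\<exists>B. step\<^sup>*\<^sup>* (A, T) (B, T) \<and> database (insert \<sigma> S) (B, T) \<and>
    agree_on A B (- {\<sigma>}) \<and> total_on_funs B {\<sigma>}"
proof -
  have T: "\<Union> (syms ` T) \<subseteq> S"
    using db by (auto simp: database_def)
  obtain a where a: "a \<in> universe A"
    using db by (auto simp: database_def is_structure_def)
  show ?thesis
  proof (cases \<sigma>)
    case (Cst c)
    show ?thesis
    proof (cases "\<sigma> \<in> S")
      case True
      then show ?thesis
        using db Cst by (auto simp: insert_absorb agree_on_def total_on_funs_def intro!: exI[of _ A])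
    next
      case False
      then have "step (A, T) (add_con \<sigma> a A, T)" "database (insert \<sigma> S) (add_con \<sigma> a A, T)"
        using step_add_con[OF db _ sg _ a] Cst by auto
      moreover have "agree_on A (add_con \<sigma> a A) (- {\<sigma>})"
        by (simp add: agree_on_add_con)
      moreover have "total_on_funs (add_con \<sigma> a A) {\<sigma>}"
        using Cst by (simp add: total_on_funs_def)
      ultimately show ?thesis by blast
    qed
  next
    case (Rel r n)
    show ?thesis
    proof (cases "\<sigma> \<in> S")
      case True
      then show ?thesis
        using db Rel by (auto simp: insert_absorb agree_on_def total_on_funs_def intro!: exI[of _ A])
    next
      case False
      let ?B = "add_tuple \<sigma> (replicate n a) A"
      have "n > 0"
        using sg Rel by (auto simp: signature_def intro: gr0I)
      then have "step (A, T) (?B, T)" "database (insert \<sigma> S) (?B, T)"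
        using step_add_tuple[OF db _ sg, of "replicate n a"] T False Rel a by auto
      moreover have "agree_on A ?B (- {\<sigma>})"
        by (simp add: agree_on_add_tuple)
      moreover have "total_on_funs ?B {\<sigma>}"
        using Rel by (simp add: total_on_funs_def)
      ultimately show ?thesis by blast
    qed
  next
    case (Fun f m)
    let ?X = "{as. set as \<subseteq> universe A \<and> length as = m}"
    have fin: "finite ?X"
      using db by (intro finite_lists_length_eq) (auto simp: database_def)
    \<comment> \<open>Nonemptiness of \<open>?X\<close> discharges the assumption \<open>new\<close>
      of \<open>steps_complete_fun\<close>, so the symbol need not be in \<open>S\<close>.\<close>
    have "replicate m a \<in> ?X"
      using a by auto
    then have "?X \<noteq> {}"
      by blast
    then obtain B where B: "step\<^sup>*\<^sup>* (A, T) (B, T)" "database (insert \<sigma> S) (B, T)"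
      "agree_on A B (- {\<sigma>})" "\<forall>as\<in>?X. \<exists>b. as @ [b] \<in> rel B \<sigma>"
      using steps_complete_fun[OF db sg[unfolded Fun] fin] Fun by blast
    moreover have "total_on_funs B {\<sigma>}"
      using B(3,4) Fun by (simp add: total_on_funs_def agree_on_def)
    ultimately show ?thesis by blast
  qed
qed

lemma steps_interpret:
  assumes "finite F" "signature F" "database S (A, T)"
  shows "\<exists>B. step\<^sup>*\<^sup>* (A, T) (B, T) \<and> database (F \<union> S) (B, T) \<and> total_on_funs B F"
  using assms
proof (induction F)
  case empty
  then show ?case by (auto simp: total_on_funs_def)
next
  case (insert \<sigma> F)
  have sg: "signature F" "signature {\<sigma>}"
    using insert.prems(1) by (auto simp: signature_def)
  then obtain B where B: "step\<^sup>*\<^sup>* (A, T) (B, T)" "database (F \<union> S) (B, T)" "total_on_funs B F"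
    using insert.IH insert.prems(2) by blast
  obtain C where C: "step\<^sup>*\<^sup>* (B, T) (C, T)" "database (insert \<sigma> (F \<union> S)) (C, T)"
    "agree_on B C (- {\<sigma>})" "total_on_funs C {\<sigma>}"
    using steps_interpret_symbol[OF B(2) sg(2)] by blast
  \<comment> \<open>The insertions for the last symbol leave the universe and all other symbols
    alone, so graphs completed earlier remain total.\<close>
  have "agree_on B C F"
    using C(3) insert.hyps(2) by (auto intro: agree_on_mono)
  then have "total_on_funs C F"
    using B(3) agree_on_total by blast
  then have "total_on_funs C (insert \<sigma> F)"
    using C(4) by (auto simp: total_on_funs_def)
  then show ?case
    using B(1) C(1,2) by (auto intro: rtranclp_trans)
qed

section \<open>Conditionals with new symbols\<close>

text \<open>
  The structure of a database need not be a model in the sense of consequence: function symbols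
  that do not occur in the theory may have incomplete graphs.  They are filled up here.
\<close>

lemma database_theory_has_model:
  fixes A :: "('s, 'a) struct"
  assumes db: "database S (A, T)"
  shows "\<exists>B :: ('s, 'a) struct.
    is_structure B \<and> sig B = S \<and> total_on_funs B S \<and> (\<forall>q\<in>T. true_in B q)"
proof -
  have A: "is_structure A" "sig A = S"
    using db by (auto simp: database_def)
  obtain a where a: "a \<in> universe A"
    using A by (auto simp: is_structure_def)
  define fill where "fill f m = {as @ [a] | as. length as = m \<and> set as \<subseteq> universe A \<and>
    (\<forall>b. as @ [b] \<notin> rel A (Fun f m))}" for f m
  define B where "B = A\<lparr>rel := \<lambda>\<sigma>. rel A \<sigma> \<union> (case \<sigma> of Fun f m \<Rightarrow> fill f m | _ \<Rightarrow> {})\<rparr>"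
  have "is_structure B"
    unfolding is_structure_def
  proof (intro conjI allI ballI impI)
    show "rel B \<tau> \<subseteq> {as. length as = arity \<tau> \<and> set as \<subseteq> universe B}"
      if "\<tau> \<in> sig B" "arity \<tau> > 0" for \<tau>
    proof -
      have "rel A \<tau> \<subseteq> {as. length as = arity \<tau> \<and> set as \<subseteq> universe A}"
        using that A(1) by (simp add: B_def is_structure_def)
      then show ?thesis
        using a by (cases \<tau>) (auto simp: B_def fill_def)
    qed
    show "b = b'" if "Fun f m \<in> sig B" "cs @ [b] \<in> rel B (Fun f m)"
      "cs @ [b'] \<in> rel B (Fun f m)" for f m cs b b'
      using that A unfolding is_structure_def B_def fill_def by auto
  qed (use A in \<open>auto simp: B_def is_structure_def\<close>)
  moreover have "total_on_funs B S"
    by (auto simp: total_on_funs_def B_def fill_def)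
  moreover have "agree_on A B (\<Union> (syms ` T))"
  proof -
    \<comment> \<open>Graphs of function symbols in the theory are total already, so filling adds
      nothing to them and the theory stays true.\<close>
    have "fill f m = {}" if "Fun f m \<in> \<Union> (syms ` T)" for f m
      using theory_funs_total[OF db] that unfolding total_on_funs_def fill_def by blast
    then show ?thesis
      by (auto simp: agree_on_def B_def split: symbol.splits)
  qed
  moreover have "sig B = S"
    using A by (simp add: B_def)
  ultimately show ?thesis
    using database_agree[OF db, of B] by (auto simp: database_def)
qed

section \<open>Positive informativity\<close>

lemma finite_syms_tm: "finite (syms_tm t)"
  by (induction t) auto

lemma finite_syms: "finite (syms p)"
  by (induction p) (auto simp: finite_syms_tm)

text \<open>With \<open>U\<close> as the only candidate, \<open>p\<close> is relevant and the
  relevancy is 1, while the complexity is the first stage at which \<open>p\<close> is true, which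
  is not stage 0. Allowing repetitions of \<open>p\<close> in \<open>ps\<close> covers both
  \<open>[p]\<close> and the support deduction of \<open>[p]\<close>.\<close>

lemma informativity_singleton_pos:
  fixes D :: "('s, 'a) database"
  assumes U: "update D U" "satisfactory U p" and p: "is_proposition p"
    and D: "\<not> true_in (fst D) p" "\<not> entails TYPE('a) (sig (fst D)) (snd D) p"
    and ps: "set ps = {p}" "last ps = p" "k < length ps"
  shows "informativity {U} ps k > 0"
proof -
  have "premisses ps k \<noteq> []" "set (premisses ps k) \<subseteq> {p}"
    using ps set_take_subset[of "Suc k" ps] by (auto simp: premisses_def)
  then have set_prem: "set (premisses ps k) = {p}"
    by (metis set_empty subset_singletonD)
  then have sup: "support ps k = {p}"
    using ps by (simp add: support_def)
  have "valid_deduction TYPE('a) ps k"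
    using p ps set_prem by (simp add: valid_deduction_def deduction_def entails_def)
  moreover have "smallest_update {U} p = U"
    using smallest_update_satisfactory[of U "{U}" p] U(2) by simp
  moreover have "U 0 = Some D"
    using U(1) by (simp add: update_def)
  ultimately have "relevancy {U} ps k = 1"
    using U(2) D(2) ps(2) sup by (simp add: relevancy_def relevant_def stage_def Collect_conv_if)
  moreover have "complexity_deduction {U} ps > 0"
  proof -
    obtain n where n: "dom U = {..n}" "true_in (stage U n) p"
      using U(2) by (auto simp: satisfactory_def)
    have "true_in (stage U (upd_norm U p)) p"
      \<comment> \<open>The least index is attained, since the final stage \<open>n\<close>
        qualifies.\<close>
      unfolding upd_norm_def by (rule LeastI2[of _ n]) (use n in auto)
    moreover have "\<not> true_in (stage U 0) p"
      using D(1) \<open>U 0 = Some D\<close> by (simp add: stage_def)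
    ultimately have "upd_norm U p > 0"
      by (metis gr0I)
    then show ?thesis
      using U(2) ps(1) by (simp add: complexity_deduction_def complexity_def Least_equality)
  qed
  ultimately show ?thesis
    by (simp add: informativity_def)
qed

lemma satisfactory_last:
  assumes "dom U = {..n}" "U n = Some (B, T)" "true_in B p"
  shows "satisfactory U p"
  using assms by (auto simp: satisfactory_def stage_def intro!: exI[of _ n])

lemma informativity_conditional_pos:
  fixes D :: "('s, 'a) database"
  assumes db: "database S D" and valid: "valid_deduction TYPE('a) ps k"
    and new: "\<exists>p\<in>support ps k. \<not> syms p \<subseteq> S"
  shows "\<exists>\<U>. (\<forall>U\<in>\<U>. update D U) \<and> informativity_prop \<U> (conditional ps k) > 0"
proof -
  let ?p = "conditional ps k"
  obtain A T where D: "D = (A, T)" by force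
  note db = db[unfolded D]
  have ded: "deduction ps k"
    using valid by (simp add: valid_deduction_def)
  have p: "is_proposition ?p"
    using ded by (rule is_proposition_conditional)
  have notin: "\<not> syms ?p \<subseteq> S"
    using new syms_conditional[OF ded] by auto
  obtain B where B: "step\<^sup>*\<^sup>* (A, T) (B, T)" "database (syms ?p \<union> S) (B, T)"
    "total_on_funs B (syms ?p)"
    using steps_interpret[OF finite_syms _ db] p by (auto simp: is_proposition_def)
  have "true_in B ?p"
    using B(2,3) by (intro true_in_conditional[OF valid]) (auto simp: database_def interprets_def)
  moreover obtain U n where U: "update D U" "dom U = {..n}" "U n = Some (B, T)"
    using update_of_steps[OF B(1)] D by blast
  ultimately have "satisfactory U ?p"
    using satisfactory_last by blast
  \<comment> \<open>Truth presupposes interpretation, so a missing symbol makes the conditional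
    untrue in \<open>D\<close> and in every model of \<open>T\<close> over \<open>S\<close>.\<close>
  moreover have not_true: "\<not> true_in C ?p" if "sig C = S" for C :: "('s, 'a) struct"
    using notin that by (simp add: true_in_def interprets_def)
  moreover have "\<not> entails TYPE('a) S T ?p"
    using database_theory_has_model[OF db] not_true by (auto simp: entails_def)
  moreover have "sig A = S"
    using db by (simp add: database_def)
  ultimately have "informativity {U} [?p] 0 > 0"
    using p U(1) D by (intro informativity_singleton_pos) auto
  then show ?thesis
    using U(1) by (intro exI[of _ "{U}"]) (simp add: informativity_prop_def)
qed

text \<open>The example infers \<open>Ex 0 (Pred r [Var 0])\<close> from itself, over a one-element
  structure with empty \<open>r\<close> and empty theory; inserting \<open>[a]\<close> makes the
  sentence true.\<close>

lemma informative_support_deduction: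
  "\<exists>(S :: 's symbol set) (D :: ('s, 'a) database) \<U> ps k.
     signature S \<and> database S D \<and> (\<forall>U\<in>\<U>. update D U) \<and>
     valid_deduction TYPE('a) ps k \<and> (\<forall>p\<in>set ps. syms p \<subseteq> S) \<and>
     informativity \<U> (support_deduction ps k) k \<noteq> 0"
proof -
  fix r :: 's and a :: 'a
  let ?\<sigma> = "Rel r 1"
  let ?S = "{?\<sigma>}"
  let ?p = "Ex 0 (Pred r [Var 0])"
  define A :: "('s, 'a) struct"
    where "A = \<lparr>sig = ?S, universe = {a}, con = (\<lambda>_. a), rel = (\<lambda>_. {})\<rparr>"
  let ?B = "add_tuple ?\<sigma> [a] A"
  have sg: "signature ?S"
    by (simp add: signature_def)
  have A: "is_structure A" "sig A = ?S"
    using sg by (simp_all add: A_def is_structure_def)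
  then have db: "database ?S (A, {})"
    by (simp add: database_def A_def)
  have p: "is_proposition ?p"
    using sg by (simp add: is_proposition_def)
  have "step (A, {}) (?B, {})"
    using step_add_tuple[OF db, of ?\<sigma> "[a]"] sg by (simp add: A_def)
  then obtain U n where U: "update (A, {}) U" "dom U = {..n}" "U n = Some (?B, {})"
    using update_of_steps[OF r_into_rtranclp] by blast
  have "true_in ?B ?p"
    by (simp add: true_in_def interprets_def total_on_funs_def add_tuple_def A_def)
  then have sat: "satisfactory U ?p"
    using U(2,3) satisfactory_last by blast
  have "\<not> sat A (\<lambda>_. a) ?p"
    by (simp add: A_def)
  then have not_true: "\<not> true_in A ?p"
    by (auto simp: true_in_def A_def)
  moreover have "total_on_funs A ?S"
    by (simp add: total_on_funs_def)
  ultimately have "\<not> entails TYPE('a) ?S {} ?p"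
    using A by (auto simp: entails_def)
  then have "informativity {U} (support_deduction [?p] 0) 0 > 0"
    using not_true A(2)
    by (intro informativity_singleton_pos[OF U(1) sat p])
      (simp_all add: support_deduction_def premisses_def)
  moreover have "valid_deduction TYPE('a) [?p] 0"
    using p by (simp add: valid_deduction_def deduction_def entails_def premisses_def)
  ultimately have "signature ?S \<and> database ?S (A, {}) \<and> (\<forall>U\<in>{U}. update (A, {}) U) \<and>
     valid_deduction TYPE('a) [?p] 0 \<and> (\<forall>p\<in>set [?p]. syms p \<subseteq> ?S) \<and>
     informativity {U} (support_deduction [?p] 0) 0 \<noteq> 0"
    using sg db U(1) by simp
  then show ?thesis by blast
qed

theorem theorem5p3:
  shows
    "(\<forall>(S :: 's symbol set) (D :: ('s, 'a::infinite) database) \<U> ps k.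
        signature S \<longrightarrow> database S D \<longrightarrow> (\<forall>U\<in>\<U>. update D U) \<longrightarrow>
        valid_deduction TYPE('a) ps k \<longrightarrow> (\<forall>p\<in>set ps. syms p \<subseteq> S) \<longrightarrow>
        informativity_prop \<U> (conditional ps k) = 0)
     \<and>
     (\<exists>(S :: 's symbol set) (D :: ('s, 'a) database) \<U> ps k.
        signature S \<and> database S D \<and> (\<forall>U\<in>\<U>. update D U) \<and>
        valid_deduction TYPE('a) ps k \<and> (\<forall>p\<in>set ps. syms p \<subseteq> S) \<and>
        informativity \<U> (support_deduction ps k) k \<noteq> 0)
     \<and>
     (\<forall>(S :: 's symbol set) (D :: ('s, 'a) database) ps k.
        signature S \<longrightarrow> database S D \<longrightarrow>
        valid_deduction TYPE('a) ps k \<longrightarrow> (\<exists>p\<in>support ps k. \<not> syms p \<subseteq> S) \<longrightarrow>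
        (\<exists>\<U>. (\<forall>U\<in>\<U>. update D U) \<and> informativity_prop \<U> (conditional ps k) > 0))"
proof (intro conjI allI impI)
qed (blast intro: informativity_conditional_eq_0 informative_support_deduction
  informativity_conditional_pos)+

end
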